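(* Suppose $\|\mathbf{s}\|<1$, and let $t_b=\inf_{\mathbf{r}\in R}t_{\mathbf{r}}$ and $t_w=\sup_{\mathbf{r}\in R}t_{\mathbf{r}}$. Then both are attained on $R$, and for every $\mathbf{b}\in R$ with $t_{\mathbf{b}}=t_b$ one has $$\mathbf{s}=\tfrac12(t_w-t_b)\,\mathbf{b}.$$ Moreover, if $\mathbf{s}\neq\theta$, then $t_b=t_0+1-\|\mathbf{s}\|$ is attained only at $\mathbf{s}/\|\mathbf{s}\|$, and $t_w=t_0+1+\|\mathbf{s}\|$ is attained only at $-\mathbf{s}/\|\mathbf{s}\|$.
   Context: $(X;\|\cdot\|)$ is a real normed space with zero $\theta$, $\dim X\geq2$, whose norm is strictly convex: for all $\mathbf{x}\neq\mathbf{y}$ with $\|\mathbf{x}\|=\|\mathbf{y}\|=1$ and all $\lambda\in(0;1)$, $\|\lambda\mathbf{x}+(1-\lambda)\mathbf{y}\|<1$. The set of sensors is the unit sphere $R=\{\mathbf{r}\in X\mid\|\mathbf{r}\|=1\}$. The source $\mathbf{s}\in X$ and the moment $t_0\in\mathbb{R}$ are fixed, and for $\mathbf{r}\in R$, $t_{\mathbf{r}}=t_0+\|\mathbf{r}-\mathbf{s}\|$. *)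

theory Defs
  imports "HOL-Analysis.Elementary_Metric_Spaces" "HOL-Analysis.Elementary_Normed_Spaces"
begin

definition strictly_convex_norm :: "'a::real_normed_vector itself \<Rightarrow> bool" where
  "strictly_convex_norm _ \<longleftrightarrow>
     (\<forall>x y :: 'a. \<forall>l :: real. x \<noteq> y \<longrightarrow> norm x = 1 \<longrightarrow> norm y = 1 \<longrightarrow> 0 < l \<longrightarrow> l < 1 \<longrightarrow>
        norm (l *\<^sub>R x + (1 - l) *\<^sub>R y) < 1)"

(* The library's dim is 0 on infinite-dimensional spaces, which are allowed here;
   hence two linearly independent vectors instead of 2 <= dim UNIV. *)
definition dim_at_least_two :: "'a::real_vector itself \<Rightarrow> bool" where
  "dim_at_least_two _ \<longleftrightarrow> (\<exists>x y :: 'a. x \<noteq> y \<and> independent {x, y})"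

abbreviation sensors :: "'a::real_normed_vector set" where
  "sensors \<equiv> sphere 0 1"

definition arrival_time :: "real \<Rightarrow> 'a::real_normed_vector \<Rightarrow> 'a \<Rightarrow> real" where
  "arrival_time t0 s r = t0 + norm (r - s)"

end

theory Submission
  imports Defs
begin

text \<open>
  Write \<open>s = norm s *\<^sub>R u\<close> with \<open>u\<close> a unit vector. By the triangle inequality
  \<open>norm (r - s)\<close> lies between \<open>1 - norm s\<close> (the value at \<open>u\<close>) and \<open>1 + norm s\<close>
  (the value at \<open>- u\<close>) for every unit vector \<open>r\<close>. If \<open>s \<noteq> 0\<close>, strict convexity of the norm
  means that equality holds in the triangle inequality only for vectors of the same direction,
  so each extreme value is attained only once.
\<close>

text \<open>Dividing by \<open>a + b\<close> turns the sum into a convex combination of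
  \<open>x\<close> and \<open>y\<close> with weight \<open>a / (a + b)\<close>. Its norm would be 1,
  which strict convexity forbids for distinct unit vectors.\<close>

lemma strictly_convex_norm_add_eqD:
  fixes x y :: "'a::real_normed_vector"
  assumes sc: "strictly_convex_norm TYPE('a)"
    and x: "norm x = 1" and y: "norm y = 1" and pos: "0 < a" "0 < b"
    and eq: "norm (a *\<^sub>R x + b *\<^sub>R y) = a + b"
  shows "x = y"
proof (rule ccontr)
  assume "x \<noteq> y"
  define l where "l = a / (a + b)"
  have l: "0 < l" "l < 1" "1 - l = b / (a + b)"
    using pos by (auto simp: l_def field_simps)
  have "norm (l *\<^sub>R x + (1 - l) *\<^sub>R y) < 1"
    using sc x y l \<open>x \<noteq> y\<close> unfolding strictly_convex_norm_def by blast
  moreover have "l *\<^sub>R x + (1 - l) *\<^sub>R y = (1 / (a + b)) *\<^sub>R (a *\<^sub>R x + b *\<^sub>R y)"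
    by (simp add: l(3)) (simp add: l_def scaleR_add_right)
  ultimately show False
    using eq pos by simp
qed

text \<open>Normalising \<open>r - c *\<^sub>R u\<close> gives a unit vector \<open>v\<close>, and
  \<open>r\<close> is a convex combination of \<open>v\<close> and \<open>u\<close>. Since
  \<open>norm r = 1\<close>, this is the equality case above, so \<open>v = u\<close> and hence
  \<open>r = u\<close>.\<close>

lemma nearest_unit_vector_unique:
  fixes r u :: "'a::real_normed_vector"
  assumes sc: "strictly_convex_norm TYPE('a)"
    and r: "norm r = 1" and u: "norm u = 1" and c: "0 < c" "c < 1"
    and eq: "norm (r - c *\<^sub>R u) = 1 - c"
  shows "r = u"
proof -
  define v where "v = (r - c *\<^sub>R u) /\<^sub>R (1 - c)"
  have v: "norm v = 1"
    using eq c by (simp add: v_def)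
  have decomp: "r = (1 - c) *\<^sub>R v + c *\<^sub>R u"
    using c by (simp add: v_def)
  then have "v = u"
    using strictly_convex_norm_add_eqD[OF sc v u, of "1 - c" c] c r by simp
  then show ?thesis
    using decomp by (simp flip: scaleR_left_distrib)
qed

text \<open>Here the equality case applies to \<open>r\<close> and \<open>- u\<close> with
  coefficients 1 and \<open>c\<close>.\<close>

lemma farthest_unit_vector_unique:
  fixes r u :: "'a::real_normed_vector"
  assumes sc: "strictly_convex_norm TYPE('a)"
    and r: "norm r = 1" and u: "norm u = 1" and c: "0 < c"
    and eq: "norm (r - c *\<^sub>R u) = 1 + c"
  shows "r = - u"
  using strictly_convex_norm_add_eqD[OF sc r, of "- u" 1 c] u c eq by simp

text \<open>This provides a direction even for \<open>s = 0\<close>, where any unit vector serves;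
  the dimension hypothesis then supplies a nonzero vector to normalise.\<close>

lemma exists_unit_vector_scaleR:
  fixes s :: "'a::real_normed_vector"
  assumes "dim_at_least_two TYPE('a)"
  obtains u where "norm u = 1" "s = norm s *\<^sub>R u"
proof (cases "s = 0")
  case True
  obtain x y :: 'a where "independent {x, y}"
    using assms unfolding dim_at_least_two_def by blast
  then have "x \<noteq> 0"
    using dependent_zero by blast
  then show ?thesis
    using that[of "sgn x"] True by (simp add: norm_sgn)
next
  case False
  then show ?thesis
    using that[of "sgn s"] by (simp add: norm_sgn sgn_div_norm)
qed

theorem mainTheorem4:
  fixes s :: "'a::real_normed_vector" and t0 tb tw :: real
  assumes "dim_at_least_two TYPE('a)"
    and "strictly_convex_norm TYPE('a)"
    and "norm s < 1"
  defines "tb \<equiv> (INF r\<in>sensors. arrival_time t0 s r)"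
    and "tw \<equiv> (SUP r\<in>sensors. arrival_time t0 s r)"
  shows "(\<exists>b\<in>sensors. arrival_time t0 s b = tb)
    \<and> (\<exists>w\<in>sensors. arrival_time t0 s w = tw)
    \<and> (\<forall>b\<in>sensors. arrival_time t0 s b = tb \<longrightarrow> s = ((1/2) * (tw - tb)) *\<^sub>R b)
    \<and> (s \<noteq> 0 \<longrightarrow>
          tb = t0 + 1 - norm s
        \<and> {r\<in>sensors. arrival_time t0 s r = tb} = {s /\<^sub>R norm s}
        \<and> tw = t0 + 1 + norm s
        \<and> {r\<in>sensors. arrival_time t0 s r = tw} = {- (s /\<^sub>R norm s)})"
proof -
  define c where "c = norm s"
  obtain u where u: "norm u = 1" and s: "s = c *\<^sub>R u"
    using exists_unit_vector_scaleR[OF assms(1)] unfolding c_def .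
  have c: "0 \<le> c" "c < 1"
    using assms(3) by (simp_all add: c_def)
  \<comment> \<open>Both displacements are multiples of the unit vector \<open>u\<close>, so their
    lengths are the absolute values of the coefficients; \<open>c < 1\<close> fixes the sign of
    \<open>1 - c\<close>.\<close>
  have "u - s = (1 - c) *\<^sub>R u" "- u - s = (- (1 + c)) *\<^sub>R u"
    unfolding s by (simp_all add: algebra_simps)
  then have at_u: "arrival_time t0 s u = t0 + 1 - c"
    and at_minus_u: "arrival_time t0 s (- u) = t0 + 1 + c"
    using c u by (simp_all add: arrival_time_def)
  have sens: "u \<in> sensors" "- u \<in> sensors"
    using u by simp_all
  have lower: "t0 + 1 - c \<le> arrival_time t0 s r" if "r \<in> sensors" for r
    using that norm_triangle_ineq2[of r s] by (simp add: arrival_time_def c_def)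
  have upper: "arrival_time t0 s r \<le> t0 + 1 + c" if "r \<in> sensors" for r
    using that norm_triangle_ineq4[of r s] by (simp add: arrival_time_def c_def)
  \<comment> \<open>The triangle bounds are attained at \<open>u\<close> and \<open>- u\<close>, so
    the infimum and the supremum are a minimum and a maximum.\<close>
  have tb: "tb = t0 + 1 - c"
    unfolding tb_def
  proof (rule cInf_eq_minimum)
    show "t0 + 1 - c \<in> arrival_time t0 s ` sensors"
      using at_u sens(1) by (metis image_eqI)
  qed (use lower in blast)
  have tw: "tw = t0 + 1 + c"
    unfolding tw_def
  proof (rule cSup_eq_maximum)
    show "t0 + 1 + c \<in> arrival_time t0 s ` sensors"
      using at_minus_u sens(2) by (metis image_eqI)
  qed (use upper in blast)
  have nearest: "r = u" if "s \<noteq> 0" "r \<in> sensors" "arrival_time t0 s r = tb" for r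
  proof (rule nearest_unit_vector_unique[OF assms(2) _ u _ c(2)])
    show "0 < c" using that(1) by (simp add: c_def)
    show "norm (r - c *\<^sub>R u) = 1 - c"
      using that(3) tb s by (simp add: arrival_time_def)
  qed (use that in simp)
  have farthest: "r = - u" if "s \<noteq> 0" "r \<in> sensors" "arrival_time t0 s r = tw" for r
  proof (rule farthest_unit_vector_unique[OF assms(2) _ u])
    show "0 < c" using that(1) by (simp add: c_def)
    show "norm (r - c *\<^sub>R u) = 1 + c"
      using that(3) tw s by (simp add: arrival_time_def)
  qed (use that in simp)
  have half: "(1/2) * (tw - tb) = c"
    using tb tw by simp
  have locate: "s = ((1/2) * (tw - tb)) *\<^sub>R b"
    if "b \<in> sensors" "arrival_time t0 s b = tb" for b
  \<comment> \<open>For \<open>s = 0\<close> every sensor attains \<open>tb\<close>, but the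
    coefficient \<open>c\<close> vanishes, so the formula holds for each \<open>b\<close>. Otherwise
    \<open>b\<close> must be \<open>u\<close>.\<close>
  proof (cases "s = 0")
    case True
    then show ?thesis unfolding half by (simp add: c_def)
  next
    case False
    then show ?thesis unfolding half using nearest that s by blast
  qed
  have dir: "s /\<^sub>R norm s = u" if "s \<noteq> 0"
  proof -
    have "c \<noteq> 0" using that by (simp add: c_def)
    \<comment> \<open>Folding \<open>norm s\<close> into \<open>c\<close> first leaves only the
      numerator \<open>s\<close> to be replaced by \<open>c *\<^sub>R u\<close>.\<close>
    then show ?thesis unfolding c_def[symmetric] by (subst s) simp
  qed
  have attained: "arrival_time t0 s u = tb" "arrival_time t0 s (- u) = tw"
    using at_u at_minus_u tb tw by simp_all
  have unique: "{r\<in>sensors. arrival_time t0 s r = tb} = {u}"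
      "{r\<in>sensors. arrival_time t0 s r = tw} = {- u}" if "s \<noteq> 0"
    using nearest[OF that] farthest[OF that] sens attained by blast+
  have extremes: "tb = t0 + 1 - norm s" "tw = t0 + 1 + norm s"
    using tb tw by (simp_all add: c_def)
  show ?thesis
  proof (intro conjI ballI impI)
    show "\<exists>b\<in>sensors. arrival_time t0 s b = tb" "\<exists>w\<in>sensors. arrival_time t0 s w = tw"
      using sens attained by blast+
  next
    assume "s \<noteq> 0"
    then show "{r\<in>sensors. arrival_time t0 s r = tb} = {s /\<^sub>R norm s}"
        "{r\<in>sensors. arrival_time t0 s r = tw} = {- (s /\<^sub>R norm s)}"
      unfolding dir[OF \<open>s \<noteq> 0\<close>] by (fact unique)+
  qed (fact extremes locate | rule extremes)+
qed

end
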